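(* Let $k\geq 1$ be an integer and, for $j=1,\ldots,k+1$, let $F_j(s)=\sum_{n=1}^\infty a_j(n)n^{-s}$ be a Dirichlet series absolutely convergent for $\sigma>1$ with $a_j(1)\neq 0$. Suppose that the $(k+1)\times(k+1)$ matrix $\big(a_j(n)\big)_{1\leq j\leq k+1,\,1\leq n\leq k+1}$ (row $j$ being $(a_j(1),a_j(2),\ldots,a_j(k+1))$) has nonzero determinant. Then there exist infinitely many $\mathbf{c}=(c_1,\ldots,c_{k+1})\in\mathbb{C}^{k+1}$ such that the Dirichlet series $L_{\mathbf{c}}(s)=\sum_{j=1}^{k+1} c_jF_j(s)$ has at least $k$ distinct vertical strips without zeros in the region $1<\sigma<\sigma^*(L_{\mathbf{c}})$.
   Context: Write $s=\sigma+it$. For a Dirichlet series $L(s)$, $\sigma^*(L)$ denotes the least upper bound of the real parts of the zeros of $L(s)$ (in its half-plane of absolute convergence). A vertical strip without zeros is a strip $\{a<\sigma<b\}$, $a<b$, in which $L$ has no zeros. *)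

theory Defs
  imports
    "HOL-Complex_Analysis.Complex_Analysis"
    "Jordan_Normal_Form.Determinant"
begin

text \<open>
  A Dirichlet series is given by its coefficient sequence \<open>a :: nat \<Rightarrow> complex\<close>; the value \<open>a 0\<close> is
  never used.
\<close>

definition dterm :: "(nat \<Rightarrow> complex) \<Rightarrow> complex \<Rightarrow> nat \<Rightarrow> complex" where
  "dterm a s n = a (Suc n) * of_nat (Suc n) powr (- s)"

definition dseries :: "(nat \<Rightarrow> complex) \<Rightarrow> complex \<Rightarrow> complex" where
  "dseries a s = (\<Sum>n. dterm a s n)"

definition abs_conv :: "(nat \<Rightarrow> complex) \<Rightarrow> complex \<Rightarrow> bool" where
  "abs_conv a s \<longleftrightarrow> summable (\<lambda>n. norm (dterm a s n))"

definition abs_abscissa :: "(nat \<Rightarrow> complex) \<Rightarrow> ereal" where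
  "abs_abscissa a = Inf {ereal (Re s) | s. abs_conv a s}"

text \<open>
  The value is extended real: it is \<open>-\<infinity>\<close> if there are no zeros, and \<open>\<infinity>\<close> if the real parts
  of the zeros are unbounded above.
\<close>

definition sigma_star :: "(nat \<Rightarrow> complex) \<Rightarrow> ereal" where
  "sigma_star a = Sup {ereal (Re s) | s. abs_abscissa a < ereal (Re s) \<and> dseries a s = 0}"

definition vstrip :: "real \<Rightarrow> real \<Rightarrow> complex set" where
  "vstrip x y = {s. x < Re s \<and> Re s < y}"

definition zero_free_strip :: "(nat \<Rightarrow> complex) \<Rightarrow> complex set \<Rightarrow> bool" where
  "zero_free_strip a S \<longleftrightarrow>
     (\<exists>x y. x < y \<and> S = vstrip x y) \<and> (\<forall>s\<in>S. dseries a s \<noteq> 0)"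

text \<open>
  Any zero-free strip contains infinitely many smaller, even pairwise disjoint, ones. Strips are
  therefore counted only if they are maximal with respect to inclusion among the zero-free strips
  of the region \<open>1 < \<sigma> < \<sigma>*\<close>. Two different maximal strips are disjoint, and there is a
  zero whose real part lies between them (possibly on a common boundary line).
\<close>

definition strips_in_region :: "(nat \<Rightarrow> complex) \<Rightarrow> complex set set" where
  "strips_in_region a =
     {S. zero_free_strip a S \<and> S \<subseteq> {s. 1 < Re s \<and> ereal (Re s) < sigma_star a}}"

definition maximal_strips :: "(nat \<Rightarrow> complex) \<Rightarrow> complex set set" where
  "maximal_strips a =
     {S \<in> strips_in_region a. \<forall>S' \<in> strips_in_region a. S \<subseteq> S' \<longrightarrow> S' = S}"

definition lincomb_coeffs ::
    "complex Matrix.vec \<Rightarrow> (nat \<Rightarrow> nat \<Rightarrow> complex) \<Rightarrow> nat \<Rightarrow> complex" where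
  "lincomb_coeffs c a n = (\<Sum>j<dim_vec c. vec_index c j * a j n)"

lemma dseries_lincomb:
  assumes "\<And>j. j < dim_vec c \<Longrightarrow> abs_conv (a j) s"
  shows "abs_conv (lincomb_coeffs c a) s"
    and "dseries (lincomb_coeffs c a) s = (\<Sum>j<dim_vec c. vec_index c j * dseries (a j) s)"
proof -
  have eq: "dterm (lincomb_coeffs c a) s n = (\<Sum>j<dim_vec c. vec_index c j * dterm (a j) s n)" for n
    by (simp add: dterm_def lincomb_coeffs_def sum_distrib_right mult.assoc)
  have sm: "summable (\<lambda>n. norm (vec_index c j * dterm (a j) s n))" if "j < dim_vec c" for j
    using assms[OF that] by (simp add: abs_conv_def norm_mult summable_mult)
  have "summable (\<lambda>n. \<Sum>j<dim_vec c. norm (vec_index c j * dterm (a j) s n))"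
    by (rule summable_sum) (use sm in auto)
  then show "abs_conv (lincomb_coeffs c a) s"
    unfolding abs_conv_def eq
    by (rule summable_comparison_test[rotated]) (auto intro!: exI[of _ 0] norm_sum)
  have "(\<Sum>n. \<Sum>j<dim_vec c. vec_index c j * dterm (a j) s n)
      = (\<Sum>j<dim_vec c. \<Sum>n. vec_index c j * dterm (a j) s n)"
    by (rule suminf_sum) (rule summable_norm_cancel[OF sm], simp)
  also have "\<dots> = (\<Sum>j<dim_vec c. vec_index c j * dseries (a j) s)"
  proof (rule sum.cong[OF refl])
    fix j assume "j \<in> {..<dim_vec c}"
    then have "summable (dterm (a j) s)"
      using assms by (auto simp: abs_conv_def intro: summable_norm_cancel)
    then show "(\<Sum>n. vec_index c j * dterm (a j) s n) = vec_index c j * dseries (a j) s"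
      by (simp add: dseries_def suminf_mult)
  qed
  finally show "dseries (lincomb_coeffs c a) s = (\<Sum>j<dim_vec c. vec_index c j * dseries (a j) s)"
    by (simp add: dseries_def eq)
qed

end

theory Submission
  imports Defs "HOL-Real_Asymp.Real_Asymp"
begin

text \<open>
  Since the matrix is invertible, for every \<open>m \<le> k + 1\<close> some combination \<open>G\<^sub>m\<close> of the given series has
  the leading term \<open>m\<^sup>-\<^sup>s\<close>. Start with \<open>G\<^bsub>k+1\<^esub>\<close> and successively add tiny multiples of
  \<open>G\<^sub>k\<close>, \<open>\<dots>\<close>, \<open>G\<^sub>1\<close>. Suppose \<open>L\<close> has leading term \<open>b(p + 1)\<^sup>-\<^sup>s\<close>, so that \<open>L\<close> has no zeros far to the
  right. Then \<open>L - b(p/(p + 1))\<^sup>N G\<^sub>p\<close> is, for large \<open>N\<close>, so close to \<open>L\<close> that the zeros and zero-free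
  strips found before survive and a further zero-free strip appears to their right, while near
  \<open>s = N\<close> the two leading terms cancel and produce a new zero. Scaling gives infinitely many \<open>c\<close>.
\<close>

section \<open>Persistence of zeros\<close>

text \<open>A form of Hurwitz's theorem. The point \<open>\<beta>\<close> excludes
  \<open>f = 0\<close>, so \<open>\<xi>\<close> is an isolated zero and |f| has a positive minimum
  \<open>\<mu>\<close> on a small circle around it. If \<open>g\<close> were within
  \<open>\<mu>/2\<close> of \<open>f\<close> and had no zero in the disc, the maximum principle for
  \<open>1/g\<close> would bound |g| at the centre below by \<open>\<mu>/2\<close>, against
  closeness at \<open>\<xi>\<close>.\<close>

lemma zero_persists:
  assumes S: "open S" "connected S" and f: "f holomorphic_on S"
    and \<xi>: "\<xi> \<in> S" "f \<xi> = 0" and \<beta>: "\<beta> \<in> S" "f \<beta> \<noteq> 0" and R: "R > 0"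
  shows "\<exists>\<epsilon>>0. \<forall>g. g holomorphic_on S \<longrightarrow>
           (\<forall>w \<in> ball \<xi> R \<inter> S. norm (g w - f w) < \<epsilon>) \<longrightarrow> (\<exists>w \<in> ball \<xi> R \<inter> S. g w = 0)"
proof -
  obtain r where r: "0 < r" "ball \<xi> r \<subseteq> S" "\<And>z. z \<in> ball \<xi> r - {\<xi>} \<Longrightarrow> f z \<noteq> 0"
    using isolated_zeros[OF f S \<xi> \<beta>] by blast
  \<comment> \<open>Halving makes the closed disc fit inside both the isolating disc and the
    prescribed ball.\<close>
  define \<rho> where "\<rho> = min r R / 2"
  have \<rho>: "0 < \<rho>" "\<rho> < r" "\<rho> < R" using r R by (auto simp: \<rho>_def)
  have cb: "cball \<xi> \<rho> \<subseteq> ball \<xi> R \<inter> S" "cball \<xi> \<rho> \<subseteq> ball \<xi> r" using \<rho> r by auto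
  have "continuous_on (sphere \<xi> \<rho>) (\<lambda>w. norm (f w))"
    by (intro continuous_intros holomorphic_on_imp_continuous_on holomorphic_on_subset[OF f])
       (use cb in auto)
  moreover have "sphere \<xi> \<rho> \<noteq> {}" using \<rho> by simp
  ultimately obtain w0 where w0: "w0 \<in> sphere \<xi> \<rho>"
    "\<And>w. w \<in> sphere \<xi> \<rho> \<Longrightarrow> norm (f w0) \<le> norm (f w)"
    using continuous_attains_inf[OF compact_sphere] by blast
  define \<mu> where "\<mu> = norm (f w0)"
  have "w0 \<in> ball \<xi> r - {\<xi>}" using w0(1) \<rho> by auto
  then have \<mu>: "\<mu> > 0" using r(3) by (simp add: \<mu>_def)
  show ?thesis
  proof (intro exI[of _ "\<mu>/2"] conjI allI impI)
    show "\<mu>/2 > 0" using \<mu> by simp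
    fix g assume g: "g holomorphic_on S"
      and close: "\<forall>w \<in> ball \<xi> R \<inter> S. norm (g w - f w) < \<mu>/2"
    show "\<exists>w \<in> ball \<xi> R \<inter> S. g w = 0"
    proof (rule ccontr)
      assume "\<not> ?thesis"
      then have nz: "g w \<noteq> 0" if "w \<in> cball \<xi> \<rho>" for w using that cb(1) by blast
      have h: "(\<lambda>w. inverse (g w)) holomorphic_on cball \<xi> \<rho>"
        by (intro holomorphic_intros holomorphic_on_subset[OF g]) (use cb nz in auto)
      have "norm (inverse (g \<xi>)) \<le> 2 / \<mu>"
      proof (rule maximum_modulus_frontier[of "\<lambda>w. inverse (g w)" "cball \<xi> \<rho>"])
        show "(\<lambda>w. inverse (g w)) holomorphic_on interior (cball \<xi> \<rho>)"
          using h holomorphic_on_subset interior_subset by blast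
        show "continuous_on (closure (cball \<xi> \<rho>)) (\<lambda>w. inverse (g w))"
          using holomorphic_on_imp_continuous_on[OF h] by simp
        fix w assume "w \<in> frontier (cball \<xi> \<rho>)"
        then have w: "w \<in> sphere \<xi> \<rho>" using \<rho> by (simp add: frontier_cball)
        then have "w \<in> cball \<xi> \<rho>" by auto
        then have "norm (g w - f w) < \<mu>/2" using close cb(1) by blast
        moreover have "norm (f w) \<ge> \<mu>" using w0(2)[OF w] by (simp add: \<mu>_def)
        ultimately have "\<mu>/2 \<le> norm (g w)"
          using norm_triangle_ineq2[of "f w" "g w"] by (simp add: norm_minus_commute)
        then show "norm (inverse (g w)) \<le> 2 / \<mu>"
          using \<mu> le_imp_inverse_le[of "\<mu>/2" "norm (g w)"] by (simp add: norm_inverse)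
      qed (use \<rho> in auto)
      moreover have "norm (g \<xi>) < \<mu>/2" using bspec[OF close, of \<xi>] \<xi> R by simp
      moreover have "g \<xi> \<noteq> 0" using nz[of \<xi>] \<rho> by simp
      ultimately show False
        using \<mu> by (simp add: norm_inverse norm_divide field_simps)
    qed
  qed
qed

section \<open>Alternating chains of strips and zeros\<close>

text \<open>
  A zero-free strip is recorded with a positive lower bound for \<open>f\<close> because non-vanishing alone is
  not stable under uniformly small perturbations.
\<close>

primrec strip_zero_chain :: "(complex \<Rightarrow> complex) \<Rightarrow> nat \<Rightarrow> real \<Rightarrow> bool" where
  "strip_zero_chain f 0 X \<longleftrightarrow> 1 \<le> X"
| "strip_zero_chain f (Suc r) Y \<longleftrightarrow>
     (\<exists>X u v z \<delta>. strip_zero_chain f r X \<and> X < u \<and> u < v \<and> v < Re z \<and> Re z < Y \<and> f z = 0 \<and>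
        \<delta> > 0 \<and> (\<forall>s. u \<le> Re s \<longrightarrow> Re s \<le> v \<longrightarrow> \<delta> \<le> norm (f s)))"

lemma strip_zero_chain_SucI:
  assumes "strip_zero_chain f r X" "X < u" "u < v" "v < Re z" "Re z < Y" "f z = 0" "\<delta> > 0"
    and "\<And>s. u \<le> Re s \<Longrightarrow> Re s \<le> v \<Longrightarrow> \<delta> \<le> norm (f s)"
  shows "strip_zero_chain f (Suc r) Y"
  using assms unfolding strip_zero_chain.simps by blast

lemma strip_zero_chain_ge_1: "strip_zero_chain f r X \<Longrightarrow> 1 \<le> X"
  by (induction r arbitrary: X) force+

text \<open>A chain imposes finitely many conditions, each stable under small perturbations: zeros
  by \<open>zero_persists\<close>, strips by their lower bounds. Closeness is asked only on a
  half-plane with \<open>A > 1\<close>, since a Dirichlet series may be unbounded near the line Re s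
  = 1.\<close>

lemma strip_zero_chain_perturb:
  assumes f: "f holomorphic_on {s. Re s > 1}" and ch: "strip_zero_chain f r X"
  shows "\<exists>A>1. \<exists>\<epsilon>>0. \<forall>g. g holomorphic_on {s. Re s > 1} \<longrightarrow>
           (\<forall>s. Re s \<ge> A \<longrightarrow> norm (g s - f s) < \<epsilon>) \<longrightarrow> strip_zero_chain g r X"
  using ch
proof (induction r arbitrary: X)
  case 0
  then show ?case by (intro exI[of _ "2::real"] conjI exI[of _ "1::real"]) auto
next
  case (Suc r Y)
  let ?H = "{s. Re s > 1}"
  from Suc.prems obtain X u v z \<delta> where c: "strip_zero_chain f r X" "X < u" "u < v" "v < Re z"
    "Re z < Y" "f z = 0" "\<delta> > 0" "\<And>s. u \<le> Re s \<Longrightarrow> Re s \<le> v \<Longrightarrow> \<delta> \<le> norm (f s)"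
    by auto
  have X: "1 \<le> X" using strip_zero_chain_ge_1 c(1) .
  from Suc.IH[OF c(1)] obtain A \<epsilon>1 where 1: "A > 1" "\<epsilon>1 > 0"
    "\<And>g. \<lbrakk>g holomorphic_on ?H; \<And>s. Re s \<ge> A \<Longrightarrow> norm (g s - f s) < \<epsilon>1\<rbrakk>
       \<Longrightarrow> strip_zero_chain g r X"
    by blast
  \<comment> \<open>Any zero within \<open>R\<close> of \<open>z\<close> still lies strictly between
    the strip and \<open>Y\<close>.\<close>
  define R where "R = min (Re z - v) (Y - Re z)"
  have Rball: "v < Re w \<and> Re w < Y" if "w \<in> ball z R" for w
  proof -
    have "\<bar>Re w - Re z\<bar> < R"
      using that abs_Re_le_cmod[of "w - z"] by (simp add: dist_norm norm_minus_commute)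
    then show ?thesis by (auto simp: R_def)
  qed
  have "\<exists>\<epsilon>>0. \<forall>g. g holomorphic_on ?H \<longrightarrow>
           (\<forall>w \<in> ball z R \<inter> ?H. norm (g w - f w) < \<epsilon>) \<longrightarrow> (\<exists>w \<in> ball z R \<inter> ?H. g w = 0)"
  proof (rule zero_persists[where \<beta> = "of_real u"])
    show "connected ?H" by (intro convex_connected convex_halfspace_Re_gt)
    show "f (of_real u) \<noteq> 0" using c(3,7) c(8)[of "of_real u"] by auto
  qed (use c X f in \<open>auto simp: R_def open_halfspace_Re_gt\<close>)
  then obtain \<epsilon>2 where 2: "\<epsilon>2 > 0"
    "\<And>g. \<lbrakk>g holomorphic_on ?H; \<And>w. w \<in> ball z R \<inter> ?H \<Longrightarrow> norm (g w - f w) < \<epsilon>2\<rbrakk>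
       \<Longrightarrow> \<exists>w \<in> ball z R \<inter> ?H. g w = 0"
    by blast
  show ?case
  \<comment> \<open>\<open>A\<close> serves the shorter chain, and \<open>u\<close> covers the new
    strip and the disc around \<open>z\<close>; half of \<open>\<delta>\<close> survives as the new
    lower bound.\<close>
  proof (rule exI[of _ "min A u"], rule conjI, (use 1 c X in simp; fail),
      rule exI[of _ "min (min \<epsilon>1 \<epsilon>2) (\<delta>/2)"], intro conjI allI impI)
    show "0 < min (min \<epsilon>1 \<epsilon>2) (\<delta>/2)" using 1 2 c by simp
    fix g assume g: "g holomorphic_on ?H"
      and cl: "\<forall>s. min A u \<le> Re s \<longrightarrow> norm (g s - f s) < min (min \<epsilon>1 \<epsilon>2) (\<delta>/2)"
    have "strip_zero_chain g r X" using 1(3)[OF g] cl by simp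
    moreover obtain w where w: "w \<in> ball z R" "g w = 0"
      using 2(2)[OF g] cl Rball c(3) by force
    moreover have "\<delta>/2 \<le> norm (g s)" if "u \<le> Re s" "Re s \<le> v" for s
    proof -
      have "norm (g s - f s) < \<delta>/2" using cl that by simp
      then show ?thesis
        using c(8)[OF that] norm_triangle_ineq2[of "f s" "g s"] by (simp add: norm_minus_commute)
    qed
    ultimately show "strip_zero_chain g (Suc r) Y"
      using c(2,3,7) Rball[OF w(1)] by (intro strip_zero_chain_SucI[of g r X u v w Y "\<delta>/2"]) auto
  qed
qed

section \<open>Dirichlet series\<close>

lemma norm_nat_powr: "n > 0 \<Longrightarrow> norm (of_nat n powr s :: complex) = real n powr Re s"
  by (simp add: norm_powr_real_powr)

lemma norm_dterm: "norm (dterm a s n) = norm (a (Suc n)) * real (Suc n) powr (- Re s)"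
  unfolding dterm_def by (simp only: norm_mult norm_nat_powr zero_less_Suc uminus_complex.sel)

lemma norm_dterm_antimono:
  assumes "A \<le> Re s" shows "norm (dterm a s n) \<le> norm (dterm a (of_real A) n)"
  unfolding norm_dterm using assms by (intro mult_left_mono powr_mono) auto

text \<open>Used to turn a small scalar multiple of a series into a uniformly small perturbation on
  a half-plane.\<close>

lemma dseries_bounded:
  assumes "abs_conv a (of_real A)"
  shows "\<exists>K. \<forall>s. Re s \<ge> A \<longrightarrow> norm (dseries a s) \<le> K"
proof (intro exI allI impI)
  fix s assume s: "A \<le> Re s"
  have 1: "summable (\<lambda>n. norm (dterm a (of_real A) n))" using assms by (simp add: abs_conv_def)
  have 2: "summable (\<lambda>n. norm (dterm a s n))"
    by (rule summable_comparison_test[OF _ 1]) (use norm_dterm_antimono[OF s] in auto)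
  show "norm (dseries a s) \<le> (\<Sum>n. norm (dterm a (of_real A) n))"
    unfolding dseries_def
    using summable_norm[OF 2] suminf_le[OF norm_dterm_antimono[OF s] 2 1] by linarith
qed

lemma dseries_holomorphic:
  assumes "\<And>s. Re s > 1 \<Longrightarrow> abs_conv a s"
  shows "dseries a holomorphic_on {s. Re s > 1}"
proof (rule holomorphic_uniform_sequence[where f = "\<lambda>N s. \<Sum>n<N. dterm a s n"])
  show "open {s. Re s > 1}" by (rule open_halfspace_Re_gt)
  show "(\<lambda>s. \<Sum>n<N. dterm a s n) holomorphic_on {s. Re s > 1}" for N
    unfolding dterm_def by (intro holomorphic_intros)
  fix x :: complex assume "x \<in> {s. Re s > 1}"
  then have x: "Re x > 1" by simp
  \<comment> \<open>Half the distance to the line Re s = 1, so the terms at \<open>1 + d\<close>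
    majorise the series on the whole disc.\<close>
  define d where "d = (Re x - 1) / 2"
  have d: "d > 0" using x by (simp add: d_def)
  have Re: "1 + d \<le> Re w" if "w \<in> cball x d" for w
  proof -
    have "\<bar>Re x - Re w\<bar> \<le> d" using that abs_Re_le_cmod[of "x - w"] by (simp add: dist_norm)
    then show ?thesis unfolding d_def by argo
  qed
  have "uniform_limit (cball x d) (\<lambda>N s. \<Sum>n<N. dterm a s n) (dseries a) sequentially"
    unfolding dseries_def
  proof (rule Weierstrass_m_test)
    show "norm (dterm a s n) \<le> norm (dterm a (of_real (1 + d)) n)" if "s \<in> cball x d" for n s
      using norm_dterm_antimono[OF Re[OF that]] .
    show "summable (\<lambda>n. norm (dterm a (of_real (1 + d)) n))"
      using assms[of "of_real (1 + d)"] d by (simp add: abs_conv_def)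
  qed
  moreover have "cball x d \<subseteq> {s. Re s > 1}" using Re d by force
  ultimately show "\<exists>d>0. cball x d \<subseteq> {s. Re s > 1} \<and>
      uniform_limit (cball x d) (\<lambda>N s. \<Sum>n<N. dterm a s n) (dseries a) sequentially"
    using d by blast
qed

text \<open>Index \<open>n\<close> stands for the integer \<open>n + 1\<close>, so the first integer
  after the leading one is \<open>q + 2\<close>. Comparing the remaining terms with those at s = 2
  gains the factor \<open>(q + 2) powr (2 - Re s)\<close>.\<close>

lemma dseries_leading_bound:
  assumes conv: "\<And>s. Re s > 1 \<Longrightarrow> abs_conv a s" and z: "\<And>n. n < q \<Longrightarrow> a (Suc n) = 0"
  shows "\<exists>K\<ge>0. \<forall>s. Re s \<ge> 2 \<longrightarrow>
    norm (dseries a s - a (Suc q) * of_nat (Suc q) powr (- s)) \<le> K * real (q + 2) powr (- Re s)"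
proof -
  define K where "K = (\<Sum>n. norm (dterm a 2 n))"
  have s2: "summable (\<lambda>n. norm (dterm a 2 n))" using conv[of 2] by (simp add: abs_conv_def)
  have K: "K \<ge> 0" unfolding K_def by (intro suminf_nonneg s2) auto
  show ?thesis
  proof (intro exI[of _ "K * real (q + 2) powr 2"] conjI allI impI)
    fix s assume s: "Re s \<ge> 2"
    define t where "t n = dterm a s n - (if n = q then dterm a s n else 0)" for n
    have ds: "dterm a s sums dseries a s"
      using conv[of s] s by (auto simp: abs_conv_def dseries_def summable_sums summable_norm_cancel)
    have ts: "t sums (dseries a s - dterm a s q)"
      unfolding t_def by (intro sums_diff ds sums_single)
    have le: "norm (t n) \<le> real (q + 2) powr (2 - Re s) * norm (dterm a 2 n)" for n
    proof (cases "n \<le> q")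
      case True
      then have "t n = 0" using z[of n] by (cases "n = q") (auto simp: t_def dterm_def)
      then show ?thesis by simp
    next
      case False
      \<comment> \<open>The exponent \<open>2 - Re s\<close> is not positive, so the first factor is
        largest at the smallest remaining integer.\<close>
      have "real (Suc n) powr (- Re s) = real (Suc n) powr (2 - Re s) * real (Suc n) powr (- 2)"
        by (simp flip: powr_add)
      also have "\<dots> \<le> real (q + 2) powr (2 - Re s) * real (Suc n) powr (- 2)"
        using False s by (intro mult_right_mono powr_mono2') auto
      finally show ?thesis using False
        by (simp add: t_def norm_dterm mult_left_mono mult.left_commute del: of_nat_Suc)
    qed
    have "norm (dseries a s - dterm a s q) = norm (suminf t)" using sums_unique[OF ts] by simp
    also have "\<dots> \<le> (\<Sum>n. real (q + 2) powr (2 - Re s) * norm (dterm a 2 n))"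
      by (intro norm_suminf_le le summable_mult s2)
    also have "\<dots> = real (q + 2) powr (2 - Re s) * K"
      unfolding K_def by (rule suminf_mult[OF s2])
    also have "\<dots> = K * real (q + 2) powr 2 * real (q + 2) powr (- Re s)"
      unfolding mult.assoc powr_add[symmetric] by simp
    finally show "norm (dseries a s - a (Suc q) * of_nat (Suc q) powr (- s))
        \<le> K * real (q + 2) powr 2 * real (q + 2) powr (- Re s)"
      by (simp add: dterm_def)
  qed (use K in simp)
qed

lemma dseries_leading_limit:
  assumes conv: "\<And>s. Re s > 1 \<Longrightarrow> abs_conv a s" and z: "\<And>n. n < q \<Longrightarrow> a (Suc n) = 0"
    and \<epsilon>: "\<epsilon> > 0"
  shows "\<exists>R. \<forall>s. Re s \<ge> R \<longrightarrow> norm (of_nat (Suc q) powr s * dseries a s - a (Suc q)) < \<epsilon>"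
proof -
  obtain K where K: "K \<ge> 0" "\<And>s. Re s \<ge> 2 \<Longrightarrow>
    norm (dseries a s - a (Suc q) * of_nat (Suc q) powr (- s)) \<le> K * real (q + 2) powr (- Re s)"
    using dseries_leading_bound[of a q, OF conv z] by blast
  \<comment> \<open>After multiplication by the leading power, the error is at most K times the
    power \<open>Re s\<close> of (q + 1)/(q + 2), that is \<open>K * exp (l * Re s)\<close>.\<close>
  define l where "l = ln (real (Suc q) / real (q + 2))"
  have l: "l < 0" unfolding l_def by simp
  have "((\<lambda>x. K * exp (l * x)) \<longlongrightarrow> 0) at_top" using l by real_asymp
  then have "\<forall>\<^sub>F x in at_top. K * exp (l * x) < \<epsilon>" using \<epsilon> by (rule order_tendstoD)
  then obtain R where R: "\<And>x. x \<ge> R \<Longrightarrow> K * exp (l * x) < \<epsilon>"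
    by (auto simp: eventually_at_top_linorder)
  show ?thesis
  proof (intro exI[of _ "max 2 R"] allI impI)
    fix s assume s: "max 2 R \<le> Re s"
    let ?p = "of_nat (Suc q) :: complex"
    have "?p powr s * ?p powr (- s) = 1"
      unfolding powr_add[symmetric] by (simp del: of_nat_Suc)
    then have "?p powr s * dseries a s - a (Suc q)
        = ?p powr s * (dseries a s - a (Suc q) * ?p powr (- s))"
      by (simp add: algebra_simps)
    also have "norm \<dots> \<le> real (Suc q) powr Re s * (K * real (q + 2) powr (- Re s))"
      unfolding norm_mult norm_nat_powr[OF zero_less_Suc]
      by (intro mult_left_mono K) (use s in auto)
    also have "\<dots> = K * exp (l * Re s)"
      by (simp add: powr_def l_def ln_div algebra_simps exp_diff exp_minus divide_simps
               del: of_nat_Suc of_nat_add)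
    also have "\<dots> < \<epsilon>" using R s by simp
    finally show "norm (?p powr s * dseries a s - a (Suc q)) < \<epsilon>" .
  qed
qed

lemma dseries_add_scaled:
  assumes "abs_conv a s" "abs_conv b s"
  shows "abs_conv (\<lambda>n. a n + e * b n) s"
    and "dseries (\<lambda>n. a n + e * b n) s = dseries a s + e * dseries b s"
proof -
  have eq: "dterm (\<lambda>n. a n + e * b n) s n = dterm a s n + e * dterm b s n" for n
    by (simp add: dterm_def algebra_simps)
  have sm: "summable (\<lambda>n. norm (dterm a s n) + norm e * norm (dterm b s n))"
    using assms by (intro summable_add summable_mult) (auto simp: abs_conv_def)
  show "abs_conv (\<lambda>n. a n + e * b n) s"
    unfolding abs_conv_def eq
    by (rule summable_comparison_test[OF _ sm])
       (auto intro!: norm_triangle_le simp: norm_mult)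
  have "dterm a s sums dseries a s" "dterm b s sums dseries b s"
    using assms by (auto simp: abs_conv_def dseries_def summable_sums summable_norm_cancel)
  from sums_add[OF this(1) sums_mult[OF this(2)]]
  show "dseries (\<lambda>n. a n + e * b n) s = dseries a s + e * dseries b s"
    unfolding dseries_def eq by (simp add: sums_iff)
qed

section \<open>Adding one strip and one zero\<close>

text \<open>With p = q + 1 and m = q + 2, the scalar \<open>e N\<close> makes the leading terms
  cancel at s = N. After the shift s = N + w and multiplication by m^s, the sum tends, uniformly for
  |w| < 1, to b (1 - (m/p)^w). This limit vanishes at w = 0, and \<open>zero_persists\<close>
  transfers the zero.\<close>

lemma eventually_new_zero:
  assumes L: "\<And>s. Re s > 1 \<Longrightarrow> abs_conv L s" and Lz: "\<And>n. n < Suc q \<Longrightarrow> L (Suc n) = 0"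
    and Lb: "L (Suc (Suc q)) \<noteq> 0"
    and G: "\<And>s. Re s > 1 \<Longrightarrow> abs_conv G s" and Gz: "\<And>n. n < q \<Longrightarrow> G (Suc n) = 0"
    and Gb: "G (Suc q) \<noteq> 0"
  defines "e \<equiv> \<lambda>N::nat. - (L (Suc (Suc q)) / G (Suc q)) * (of_nat (Suc q) / of_nat (Suc (Suc q))) ^ N"
  shows "\<forall>\<^sub>F N in sequentially. \<exists>s. \<bar>Re s - real N\<bar> < 1 \<and> dseries L s + e N * dseries G s = 0"
proof -
  let ?p = "of_nat (Suc q) :: complex" and ?m = "of_nat (Suc (Suc q)) :: complex"
  have pm0: "?p \<noteq> 0" "?m \<noteq> 0" by (simp_all del: of_nat_Suc)
  define b where "b = L (Suc (Suc q))"
  define g where "g = G (Suc q)"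
  have bg: "b \<noteq> 0" "g \<noteq> 0" using Lb Gb by (simp_all add: b_def g_def)
  \<comment> \<open>Bounds |(b/g) (m/p)^w| on the unit disc, where Re w < 1.\<close>
  define C where "C = norm (b / g) * (real (Suc (Suc q)) / real (Suc q))"
  have C: "C \<ge> 0" by (simp add: C_def)
  define h where "h w = b * (1 - ?m powr w / ?p powr w)" for w
  have "\<exists>\<epsilon>>0. \<forall>f. f holomorphic_on ball 0 1 \<longrightarrow>
     (\<forall>w \<in> ball 0 1 \<inter> ball 0 1. norm (f w - h w) < \<epsilon>) \<longrightarrow> (\<exists>w \<in> ball 0 1 \<inter> ball 0 1. f w = 0)"
  proof (rule zero_persists[where \<beta> = "1/2"])
    show "h holomorphic_on ball 0 1"
      unfolding h_def using pm0 by (intro holomorphic_intros) auto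
    show "h 0 = 0" using pm0 by (simp add: h_def)
    \<comment> \<open>The moduli of the two powers differ at w = 1/2, so \<open>h\<close> does not
      vanish identically.\<close>
    have "real (Suc (Suc q)) powr (1/2) \<noteq> real (Suc q) powr (1/2)"
      by (simp add: powr_half_sqrt)
    then have "norm (?m powr (1/2)) \<noteq> norm (?p powr (1/2))"
      unfolding norm_nat_powr[OF zero_less_Suc] by simp
    then have "?m powr (1/2) \<noteq> ?p powr (1/2)" by metis
    then show "h (1/2) \<noteq> 0" using bg pm0 by (simp add: h_def)
  qed auto
  then obtain \<epsilon> where \<epsilon>: "\<epsilon> > 0" "\<And>f. \<lbrakk>f holomorphic_on ball 0 1;
      \<And>w. w \<in> ball 0 1 \<Longrightarrow> norm (f w - h w) < \<epsilon>\<rbrakk> \<Longrightarrow> \<exists>w \<in> ball 0 1. f w = 0"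
    by auto
  \<comment> \<open>The errors of \<open>L\<close> and \<open>G\<close> enter with weights 1 and
    \<open>C\<close>, so together they stay below \<open>\<epsilon>\<close>.\<close>
  define \<eta> where "\<eta> = \<epsilon> / (1 + C)"
  have \<eta>: "\<eta> > 0" using \<epsilon> C by (simp add: \<eta>_def)
  obtain R1 where R1: "\<And>s. Re s \<ge> R1 \<Longrightarrow> norm (?m powr s * dseries L s - b) < \<eta>"
    using dseries_leading_limit[of L "Suc q", OF L Lz \<eta>] unfolding b_def by blast
  obtain R2 where R2: "\<And>s. Re s \<ge> R2 \<Longrightarrow> norm (?p powr s * dseries G s - g) < \<eta>"
    using dseries_leading_limit[of G q, OF G Gz \<eta>] unfolding g_def by blast
  \<comment> \<open>The extra 1 compensates for Re w > -1.\<close>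
  have "\<forall>\<^sub>F N in sequentially. real N \<ge> max 2 (max R1 R2) + 1"
    using filterlim_real_sequentially unfolding filterlim_at_top by blast
  then show ?thesis
  proof eventually_elim
    case (elim N)
    define f where "f w = ?m powr (of_nat N + w) *
      (dseries L (of_nat N + w) + e N * dseries G (of_nat N + w))" for w
    have Rew: "\<bar>Re w\<bar> < 1" if "w \<in> ball 0 1" for w
      using that abs_Re_le_cmod[of w] by simp
    have "\<exists>w \<in> ball 0 1. f w = 0"
    proof (rule \<epsilon>(2))
      have sub: "(\<lambda>w. of_nat N + w) ` ball 0 1 \<subseteq> {s. Re s > 1}"
        using elim Rew by fastforce
      have "(dseries L \<circ> (\<lambda>w. of_nat N + w)) holomorphic_on ball 0 1"
           "(dseries G \<circ> (\<lambda>w. of_nat N + w)) holomorphic_on ball 0 1"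
        by (rule holomorphic_on_compose_gen[OF _ dseries_holomorphic sub], intro holomorphic_intros,
            rule L G, assumption)+
      then show "f holomorphic_on ball 0 1"
        unfolding f_def o_def using pm0 by (intro holomorphic_intros) auto
      fix w assume w: "w \<in> ball (0::complex) 1"
      let ?s = "of_nat N + w"
      have m: "?m powr ?s = ?m ^ N * ?m powr w" and p: "?p powr ?s = ?p ^ N * ?p powr w"
        using pm0 by (simp_all add: powr_add powr_nat' del: of_nat_Suc)
      have "f w - h w = (?m powr ?s * dseries L ?s - b)
          - (b / g) * (?m powr w / ?p powr w) * (?p powr ?s * dseries G ?s - g)"
        unfolding f_def h_def e_def b_def[symmetric] g_def[symmetric] m p
        using pm0 bg by (simp add: field_simps power_divide del: of_nat_Suc)
      also have "norm \<dots> \<le> norm (?m powr ?s * dseries L ?s - b)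
          + norm (b / g) * norm (?m powr w / ?p powr w) * norm (?p powr ?s * dseries G ?s - g)"
        by (rule order_trans[OF norm_triangle_ineq4]) (simp only: norm_mult order.refl)
      also have "\<dots> < \<eta> + C * \<eta>"
      proof (rule add_less_le_mono)
        show "norm (?m powr ?s * dseries L ?s - b) < \<eta>"
          using R1[of ?s] elim Rew[OF w] by simp
        have "norm (?m powr w / ?p powr w) = (real (Suc (Suc q)) / real (Suc q)) powr Re w"
          unfolding norm_divide norm_nat_powr[OF zero_less_Suc] by (simp add: powr_divide)
        also have "\<dots> \<le> (real (Suc (Suc q)) / real (Suc q)) powr 1"
          using Rew[OF w] by (intro powr_mono) (auto simp: divide_simps)
        finally have "norm (?m powr w / ?p powr w) \<le> real (Suc (Suc q)) / real (Suc q)"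
          by simp
        moreover have "norm (?p powr ?s * dseries G ?s - g) \<le> \<eta>"
          using R2[of ?s] elim Rew[OF w] by (force intro: less_imp_le)
        ultimately show "norm (b / g) * norm (?m powr w / ?p powr w) *
            norm (?p powr ?s * dseries G ?s - g) \<le> C * \<eta>"
          unfolding C_def by (intro mult_mono) auto
      qed
      also have "\<eta> + C * \<eta> = \<epsilon>" 
      proof -
        have "\<eta> + C * \<eta> = (1 + C) * \<eta>" by (simp add: algebra_simps)
        then show ?thesis using C by (simp add: \<eta>_def)
      qed
      finally show "norm (f w - h w) < \<epsilon>" .
    qed
    then obtain w where w: "w \<in> ball 0 1" "f w = 0" by blast
    then have "dseries L (of_nat N + w) + e N * dseries G (of_nat N + w) = 0"
      using pm0 by (simp add: f_def del: of_nat_Suc)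
    moreover have "\<bar>Re (of_nat N + w) - real N\<bar> < 1" using Rew[OF w(1)] by simp
    ultimately show ?case by blast
  qed
qed

text \<open>The new strip is fixed first, where the leading term of \<open>L\<close> dominates. Then
  \<open>N\<close> is taken so large that the perturbation spares the old chain and this strip,
  while the new zero near \<open>N\<close> falls to the right of both. As \<open>e\<close> is
  nonzero, the term of index \<open>Suc q\<close> enters and becomes the leading one.\<close>

lemma strip_zero_chain_extend:
  assumes L: "\<And>s. Re s > 1 \<Longrightarrow> abs_conv L s" and Lz: "\<And>n. n < Suc q \<Longrightarrow> L (Suc n) = 0"
    and Lb: "L (Suc (Suc q)) \<noteq> 0"
    and G: "\<And>s. Re s > 1 \<Longrightarrow> abs_conv G s" and Gz: "\<And>n. n < q \<Longrightarrow> G (Suc n) = 0"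
    and Gb: "G (Suc q) \<noteq> 0"
    and ch: "strip_zero_chain (dseries L) r X"
  shows "\<exists>e Y. e \<noteq> 0 \<and> strip_zero_chain (dseries (\<lambda>n. L n + e * G n)) (Suc r) Y"
proof -
  let ?H = "{s. Re s > 1}" and ?m = "of_nat (Suc (Suc q)) :: complex"
  define b where "b = L (Suc (Suc q))"
  define e where "e N = - (b / G (Suc q)) * (of_nat (Suc q) / of_nat (Suc (Suc q))) ^ N" for N :: nat
  have e0: "e N \<noteq> 0" for N
    using Lb Gb by (simp add: e_def b_def del: of_nat_Suc)
  have "norm (of_nat (Suc q) / of_nat (Suc (Suc q)) :: complex) < 1"
    unfolding norm_divide norm_of_nat by simp
  then have elim0: "e \<longlonglongrightarrow> 0"
    unfolding e_def by (intro tendsto_mult_right_zero LIMSEQ_power_zero)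
  obtain A \<epsilon> where A: "A > 1" "\<epsilon> > 0"
    "\<And>g. \<lbrakk>g holomorphic_on ?H; \<And>s. Re s \<ge> A \<Longrightarrow> norm (g s - dseries L s) < \<epsilon>\<rbrakk>
       \<Longrightarrow> strip_zero_chain g r X"
    using strip_zero_chain_perturb[OF dseries_holomorphic[OF L] ch] by blast
  obtain R where R: "\<And>s. Re s \<ge> R \<Longrightarrow> norm (?m powr s * dseries L s - b) < norm b / 2"
    using dseries_leading_limit[of L "Suc q" "norm b / 2", OF L Lz] Lb unfolding b_def by auto
  define u where "u = max (max A R) X + 1"
  \<comment> \<open>The leading power decays in Re s, so its size at the right edge
    \<open>u + 1\<close> controls the strip.\<close>
  define \<delta> where "\<delta> = norm b / 2 * real (Suc (Suc q)) powr (- (u + 1))"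
  have \<delta>: "\<delta> > 0" using Lb by (simp add: \<delta>_def b_def)
  have lower: "\<delta> \<le> norm (dseries L s)" if "u \<le> Re s" "Re s \<le> u + 1" for s
  proof -
    have "norm b / 2 \<le> norm (?m powr s * dseries L s)"
      using R[of s] that norm_triangle_ineq2[of b "?m powr s * dseries L s"]
      unfolding u_def norm_minus_commute[of b] by linarith
    also have "\<dots> = real (Suc (Suc q)) powr Re s * norm (dseries L s)"
      unfolding norm_mult norm_nat_powr[OF zero_less_Suc] ..
    also have "\<dots> \<le> real (Suc (Suc q)) powr (u + 1) * norm (dseries L s)"
      using that by (intro mult_right_mono powr_mono) auto
    finally show ?thesis unfolding \<delta>_def powr_minus
      by (simp add: field_simps del: of_nat_Suc)
  qed
  obtain K where K: "\<And>s. Re s \<ge> A \<Longrightarrow> norm (dseries G s) \<le> K"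
    using dseries_bounded[of G A] G A by auto
  have "(\<lambda>N. norm (e N) * K) \<longlonglongrightarrow> 0" 
    using tendsto_mult_left_zero[OF tendsto_norm_zero[OF elim0]] .
  then have "\<forall>\<^sub>F N in sequentially. norm (e N) * K < min \<epsilon> (\<delta>/2)"
    by (rule order_tendstoD) (use A \<delta> in simp)
  \<comment> \<open>The zero lies within 1 of \<open>N\<close>, hence beyond the right edge
    \<open>u + 1\<close>.\<close>
  moreover have "\<forall>\<^sub>F N in sequentially. real N \<ge> u + 3"
    using filterlim_real_sequentially unfolding filterlim_at_top by blast
  moreover have "\<forall>\<^sub>F N in sequentially.
      \<exists>s. \<bar>Re s - real N\<bar> < 1 \<and> dseries L s + e N * dseries G s = 0"
    unfolding e_def b_def by (rule eventually_new_zero[OF L Lz Lb G Gz Gb])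
  ultimately have "\<forall>\<^sub>F N in sequentially. norm (e N) * K < min \<epsilon> (\<delta>/2) \<and> real N \<ge> u + 3 \<and>
      (\<exists>s. \<bar>Re s - real N\<bar> < 1 \<and> dseries L s + e N * dseries G s = 0)"
    by eventually_elim blast
  then obtain N z where N: "norm (e N) * K < min \<epsilon> (\<delta>/2)" "real N \<ge> u + 3"
      "\<bar>Re z - real N\<bar> < 1" "dseries L z + e N * dseries G z = 0"
    by (auto simp: eventually_sequentially)
  define f where "f = dseries (\<lambda>n. L n + e N * G n)"
  have f: "f s = dseries L s + e N * dseries G s" if "Re s > 1" for s
    unfolding f_def using dseries_add_scaled(2)[OF L[OF that] G[OF that]] .
  have close: "norm (f s - dseries L s) < min \<epsilon> (\<delta>/2)" if "Re s \<ge> A" for s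
  proof -
    have "norm (f s - dseries L s) = norm (e N) * norm (dseries G s)"
      using f that A by (simp add: norm_mult)
    also have "\<dots> \<le> norm (e N) * K" by (intro mult_left_mono K that) auto
    finally show ?thesis using N by linarith
  qed
  have "strip_zero_chain f r X"
  proof (rule A(3))
    show "f holomorphic_on ?H"
      unfolding f_def by (intro dseries_holomorphic dseries_add_scaled L G)
  qed (use close in auto)
  moreover have "\<delta>/2 \<le> norm (f s)" if "u \<le> Re s" "Re s \<le> u + 1" for s
    using lower[OF that] close[of s] that norm_triangle_ineq2[of "dseries L s" "f s"]
    unfolding u_def norm_minus_commute[of "dseries L s"] by linarith
  moreover have "X < u" by (simp add: u_def)
  moreover have "f z = 0" using f[of z] N A by (simp add: u_def)
  ultimately have "strip_zero_chain f (Suc r) (Re z + 1)"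
    using \<delta> N by (intro strip_zero_chain_SucI[of f r X u "u + 1" z _ "\<delta>/2"]) auto
  then show ?thesis using e0 unfolding f_def by blast
qed

section \<open>Maximal zero-free strips\<close>

lemma vstrip_subset_iff:
  assumes "u < v" shows "vstrip u v \<subseteq> vstrip x y \<longleftrightarrow> x \<le> u \<and> v \<le> y"
proof
  assume sub: "vstrip u v \<subseteq> vstrip x y"
  have *: "x < t \<and> t < y" if "u < t" "t < v" for t
    using subsetD[OF sub, of "of_real t"] that by (simp add: vstrip_def)
  show "x \<le> u \<and> v \<le> y"
    by (intro conjI dense_le_bounded[OF assms] dense_ge_bounded[OF assms]) (use * in force)+
qed (auto simp: vstrip_def)

text \<open>The admissible strips containing \<open>vstrip u v\<close> overlap there, so their union
  is again a strip, and it is maximal. The zero \<open>z\<close> blocks extension beyond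
  \<open>Re z\<close> and places everything left of \<open>sigma_star a\<close>.\<close>

lemma extend_to_maximal_strip:
  assumes conv: "\<And>s. Re s > 1 \<Longrightarrow> abs_conv a s"
    and u: "1 \<le> u" "u < v" and nz: "\<And>s. u < Re s \<Longrightarrow> Re s < v \<Longrightarrow> dseries a s \<noteq> 0"
    and z: "v < Re z" "dseries a z = 0"
  shows "\<exists>S \<in> maximal_strips a. vstrip u v \<subseteq> S \<and> S \<subseteq> {s. Re s < Re z}"
proof -
  \<comment> \<open>\<open>sigma_star\<close> counts only zeros right of the abscissa of absolute
    convergence; convergence at \<open>x0\<close> shows that \<open>z\<close> is one of
    them.\<close>
  obtain x0 where x0: "1 < x0" "x0 < Re z" using u z dense[of 1 "Re z"] by force
  have "abs_abscissa a \<le> ereal x0"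
    unfolding abs_abscissa_def
    by (rule Inf_lower) (use conv[of "of_real x0"] x0 in \<open>auto intro!: exI[of _ "of_real x0"]\<close>)
  then have "abs_abscissa a < ereal (Re z)" using x0 by (simp add: le_less_trans)
  then have \<sigma>: "ereal (Re z) \<le> sigma_star a"
    unfolding sigma_star_def by (intro Sup_upper) (use z in auto)
  \<comment> \<open>Strips are handled as endpoint pairs, so that the edges of the union are an
    infimum and a supremum.\<close>
  define Q where "Q = {(x, y). x \<le> u \<and> v \<le> y \<and> vstrip x y \<in> strips_in_region a}"
  have below: "1 \<le> x \<and> y \<le> Re z" if "(x, y) \<in> Q" for x y
  proof -
    have xy: "x \<le> u" "v \<le> y" and nz': "\<And>s. s \<in> vstrip x y \<Longrightarrow> dseries a s \<noteq> 0"
      and sub: "vstrip x y \<subseteq> {s. 1 < Re s}"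
      using that by (auto simp: Q_def strips_in_region_def zero_free_strip_def)
    have "z \<notin> vstrip x y" using nz'[of z] z by auto
    then have "y \<le> Re z" using xy u z by (auto simp: vstrip_def)
    moreover have "1 \<le> x"
    proof (rule dense_ge_bounded[of x v])
      fix t assume "x < t" "t < v"
      then show "1 \<le> t" using subsetD[OF sub, of "of_real t"] xy by (simp add: vstrip_def)
    qed (use xy u in simp)
    ultimately show ?thesis by simp
  qed
  have Q0: "(u, v) \<in> Q"
    unfolding Q_def strips_in_region_def zero_free_strip_def using u nz z
    by (auto simp: vstrip_def intro: less_le_trans[OF _ \<sigma>])
  define x where "x = Inf (fst ` Q)"
  define y where "y = Sup (snd ` Q)"
  have bdd: "bdd_below (fst ` Q)" "bdd_above (snd ` Q)"
    using below by (auto intro!: bdd_belowI[of _ 1] bdd_aboveI[of _ "Re z"])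
  have ext: "x \<le> x' \<and> y' \<le> y" if "(x', y') \<in> Q" for x' y'
    unfolding x_def y_def using that bdd by (force intro!: cInf_lower cSup_upper)
  have x: "1 \<le> x" "x \<le> u" and y: "v \<le> y" "y \<le> Re z"
    using ext[OF Q0] Q0 below by (force simp: x_def y_def intro!: cInf_greatest cSup_least)+
  \<comment> \<open>Left of \<open>v\<close>, a strip whose left edge is near the infimum suffices,
    as it reaches \<open>v\<close>; otherwise one whose right edge is near the supremum, as it
    starts at or before \<open>u\<close>.\<close>
  have cover: "\<exists>x' y'. (x', y') \<in> Q \<and> s \<in> vstrip x' y'" if s: "x < Re s" "Re s < y" for s
  proof (cases "Re s < v")
    case True
    obtain q where "q \<in> Q" "fst q < Re s"
      using cInf_lessD[of "fst ` Q" "Re s"] s Q0 unfolding x_def by blast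
    moreover have "v \<le> snd q" using \<open>q \<in> Q\<close> by (auto simp: Q_def)
    ultimately show ?thesis using True
      by (intro exI[of _ "fst q"] exI[of _ "snd q"]) (auto simp: vstrip_def)
  next
    case False
    obtain q where "q \<in> Q" "Re s < snd q"
      using less_cSupD[of "snd ` Q" "Re s"] s Q0 unfolding y_def by blast
    moreover have "fst q \<le> u" using \<open>q \<in> Q\<close> by (auto simp: Q_def)
    ultimately show ?thesis using False u
      by (intro exI[of _ "fst q"] exI[of _ "snd q"]) (auto simp: vstrip_def)
  qed
  have "dseries a s \<noteq> 0" if "s \<in> vstrip x y" for s
    using cover[of s] that
    by (auto simp: vstrip_def Q_def strips_in_region_def zero_free_strip_def)
  then have in_region: "vstrip x y \<in> strips_in_region a"
    unfolding strips_in_region_def zero_free_strip_def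
  proof (intro CollectI conjI)
    show "\<exists>x' y'. x' < y' \<and> vstrip x y = vstrip x' y'"
      using x y u by (intro exI[of _ x] exI[of _ y]) auto
    show "vstrip x y \<subseteq> {s. 1 < Re s \<and> ereal (Re s) < sigma_star a}"
      using x y by (auto simp: vstrip_def intro: less_le_trans[OF _ \<sigma>])
  qed auto
  have "vstrip x y \<in> maximal_strips a"
    unfolding maximal_strips_def
  proof (intro CollectI conjI ballI impI in_region)
    fix S assume S: "S \<in> strips_in_region a" "vstrip x y \<subseteq> S"
    then obtain x' y' where S': "S = vstrip x' y'"
      by (auto simp: strips_in_region_def zero_free_strip_def)
    have "x' \<le> x \<and> y \<le> y'"
      using S(2) x y u unfolding S' by (subst (asm) vstrip_subset_iff) auto
    moreover from this have "(x', y') \<in> Q" using x y S(1) by (auto simp: Q_def S')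
    ultimately show "S = vstrip x y" using ext[of x' y'] by (auto simp: S' vstrip_def)
  qed
  moreover have "vstrip u v \<subseteq> vstrip x y" "vstrip x y \<subseteq> {s. Re s < Re z}"
    using x y by (auto simp: vstrip_def)
  ultimately show ?thesis by blast
qed

text \<open>Each strip of the chain is enlarged to a maximal one, which stops at the zero that
  follows it and so cannot merge with the next. The bound by \<open>X\<close> carries this
  separation through the induction.\<close>

lemma strip_zero_chain_maximal_strips:
  assumes conv: "\<And>s. Re s > 1 \<Longrightarrow> abs_conv a s" and "strip_zero_chain (dseries a) r X"
  shows "\<exists>T \<subseteq> maximal_strips a. finite T \<and> card T = r \<and> \<Union>T \<subseteq> {s. Re s < X}"
  using assms(2)
proof (induction r arbitrary: X)
  case 0
  then show ?case by (auto intro!: exI[of _ "{}"])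
next
  case (Suc r Y)
  then obtain X u v z \<delta> where c: "strip_zero_chain (dseries a) r X" "X < u" "u < v" "v < Re z"
    "Re z < Y" "dseries a z = 0" "\<delta> > 0"
    "\<And>s. u \<le> Re s \<Longrightarrow> Re s \<le> v \<Longrightarrow> \<delta> \<le> norm (dseries a s)"
    by auto
  obtain T where T: "T \<subseteq> maximal_strips a" "finite T" "card T = r" "\<Union>T \<subseteq> {s. Re s < X}"
    using Suc.IH[OF c(1)] by blast
  have "\<exists>S \<in> maximal_strips a. vstrip u v \<subseteq> S \<and> S \<subseteq> {s. Re s < Re z}"
  proof (rule extend_to_maximal_strip[OF conv])
    show "dseries a s \<noteq> 0" if "u < Re s" "Re s < v" for s
      using c(7) c(8)[of s] that by auto
  qed (use c strip_zero_chain_ge_1[OF c(1)] in auto)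
  then obtain S where S: "S \<in> maximal_strips a" "vstrip u v \<subseteq> S" "S \<subseteq> {s. Re s < Re z}"
    by blast
  \<comment> \<open>The midpoint lies to the right of \<open>X\<close>, beyond every strip collected
    so far.\<close>
  have "of_real ((u + v) / 2) \<in> vstrip u v" using c by (simp add: vstrip_def)
  then have "of_real ((u + v) / 2) \<in> S" using S by blast
  moreover have "of_real ((u + v) / 2) \<notin> \<Union>T" using T(4) c by fastforce
  ultimately have "S \<notin> T" by blast
  moreover have "\<Union>(insert S T) \<subseteq> {s. Re s < Y}" using S(3) T(4) c by fastforce
  ultimately show ?case
    using T S by (intro exI[of _ "insert S T"]) auto
qed

section \<open>Linear combinations with prescribed coefficients\<close>

lemma lincomb_coeffs_add_smult:
  assumes "c \<in> carrier_vec n" "d \<in> carrier_vec n"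
  shows "lincomb_coeffs (c + e \<cdot>\<^sub>v d) a = (\<lambda>i. lincomb_coeffs c a i + e * lincomb_coeffs d a i)"
  using assms
  by (auto simp: lincomb_coeffs_def fun_eq_iff algebra_simps sum.distrib sum_distrib_left
      intro!: sum.cong)

lemma lincomb_coeffs_smult:
  "lincomb_coeffs (t \<cdot>\<^sub>v c) a = (\<lambda>i. t * lincomb_coeffs c a i)"
  by (auto simp: lincomb_coeffs_def fun_eq_iff sum_distrib_left mult.assoc)

text \<open>The vector sought is row \<open>i\<close> of the inverse of the coefficient
  matrix.\<close>

lemma lincomb_coeffs_dual:
  fixes a :: "nat \<Rightarrow> nat \<Rightarrow> complex"
  assumes "Determinant.det (Matrix.mat K K (\<lambda>(j, n). a j (n + 1))) \<noteq> 0" and i: "i < K"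
  shows "\<exists>c \<in> carrier_vec K. \<forall>n<K. lincomb_coeffs c a (Suc n) = (if n = i then 1 else 0)"
proof -
  define A where "A = Matrix.mat K K (\<lambda>(j, n). a j (n + 1))"
  have A: "A \<in> carrier_mat K K" by (simp add: A_def)
  obtain B where B: "B \<in> carrier_mat K K" "B * A = 1\<^sub>m K"
    using det_non_zero_imp_unit[OF A, of "()"] assms(1)
    by (auto simp: A_def Units_def ring_mat_def)
  have "lincomb_coeffs (Matrix.row B i) a (Suc n) = (if n = i then 1 else 0)" if n: "n < K" for n
  proof -
    have "lincomb_coeffs (Matrix.row B i) a (Suc n) = (B * A) $$ (i, n)"
      using A B(1) i n
      by (auto simp: lincomb_coeffs_def scalar_prod_def A_def lessThan_atLeast0 intro!: sum.cong)
    then show ?thesis using B i n by simp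
  qed
  then show ?thesis using B(1) by (intro bexI[of _ "Matrix.row B i"]) auto
qed

text \<open>Scaling changes neither zeros nor absolute convergence; this turns one suitable vector
  into infinitely many.\<close>

lemma maximal_strips_scale:
  assumes "t \<noteq> 0"
  shows "maximal_strips (\<lambda>n. t * a n) = maximal_strips a"
proof -
  have dt: "dterm (\<lambda>n. t * a n) s = (\<lambda>n. t * dterm a s n)" for s
    by (simp add: dterm_def fun_eq_iff)
  have ac: "abs_conv (\<lambda>n. t * a n) s \<longleftrightarrow> abs_conv a s" for s
    unfolding abs_conv_def dt norm_mult using assms by (simp add: summable_cmult_iff)
  have ds: "dseries (\<lambda>n. t * a n) s = 0 \<longleftrightarrow> dseries a s = 0" for s
  proof (cases "summable (dterm a s)")
    case True
    then show ?thesis unfolding dseries_def dt using assms by (simp add: suminf_mult)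
  next
    case False
    \<comment> \<open>Both sums are then the same junk value.\<close>
    then have "\<not> summable (\<lambda>n. t * dterm a s n)" using assms by (simp add: summable_cmult_iff)
    then have "suminf (\<lambda>n. t * dterm a s n) = suminf (dterm a s)"
      using False unfolding suminf_def summable_def by presburger
    then show ?thesis unfolding dseries_def dt by simp
  qed
  show ?thesis
    unfolding maximal_strips_def strips_in_region_def zero_free_strip_def sigma_star_def
      abs_abscissa_def ac ds ..
qed

theorem theorem2:
  fixes k :: nat and a :: "nat \<Rightarrow> nat \<Rightarrow> complex"
  assumes "k \<ge> 1"
    and "\<And>j s. j < k + 1 \<Longrightarrow> Re s > 1 \<Longrightarrow> abs_conv (a j) s"
    and "\<And>j. j < k + 1 \<Longrightarrow> a j 1 \<noteq> 0"
    and "Determinant.det (Matrix.mat (k + 1) (k + 1) (\<lambda>(j, n). a j (n + 1))) \<noteq> 0"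
  shows "infinite {c \<in> carrier_vec (k + 1).
           \<exists>T. T \<subseteq> maximal_strips (lincomb_coeffs c a) \<and> finite T \<and> card T = k}"
proof -
  let ?L = "\<lambda>c. lincomb_coeffs c a"
  have conv: "abs_conv (?L c) s" if "c \<in> carrier_vec (k + 1)" "Re s > 1" for c s
    using that by (intro dseries_lincomb(1) assms(2)) auto
  have "\<exists>d \<in> carrier_vec (k + 1). \<forall>n<k + 1. ?L d (Suc n) = (if n = i then 1 else 0)"
    if "i < k + 1" for i
    using lincomb_coeffs_dual[OF assms(4) that] .
  then obtain d where d: "\<And>i. i < k + 1 \<Longrightarrow> d i \<in> carrier_vec (k + 1)"
    "\<And>i n. i < k + 1 \<Longrightarrow> n < k + 1 \<Longrightarrow> ?L (d i) (Suc n) = (if n = i then 1 else 0)"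
    by metis
  \<comment> \<open>After \<open>r\<close> steps the leading term belongs to the integer
    \<open>k - r + 1\<close>. Each step moves it down by one, so at \<open>r = k\<close> the first
    coefficient is nonzero.\<close>
  have "\<exists>c \<in> carrier_vec (k + 1). (\<forall>n<k - r. ?L c (Suc n) = 0) \<and> ?L c (Suc (k - r)) \<noteq> 0 \<and>
          (\<exists>X. strip_zero_chain (dseries (?L c)) r X)" if "r \<le> k" for r
    using that
  proof (induction r)
    case 0
    then show ?case using d by (intro bexI[of _ "d k"]) auto
  next
    case (Suc r)
    then obtain c X where c: "c \<in> carrier_vec (k + 1)" "\<And>n. n < k - r \<Longrightarrow> ?L c (Suc n) = 0"
      "?L c (Suc (k - r)) \<noteq> 0" "strip_zero_chain (dseries (?L c)) r X"
      by auto
    define q where "q = k - Suc r"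
    have q: "k - r = Suc q" "q < k + 1" using Suc.prems by (auto simp: q_def)
    have "\<exists>e Y. e \<noteq> 0 \<and> strip_zero_chain (dseries (\<lambda>n. ?L c n + e * ?L (d q) n)) (Suc r) Y"
      by (rule strip_zero_chain_extend[where q = q])
         (use c d q in \<open>auto intro: conv\<close>)
    then obtain e Y where e: "e \<noteq> 0"
        "strip_zero_chain (dseries (\<lambda>n. ?L c n + e * ?L (d q) n)) (Suc r) Y"
      by blast
    have eq: "?L (c + e \<cdot>\<^sub>v d q) = (\<lambda>n. ?L c n + e * ?L (d q) n)"
      by (rule lincomb_coeffs_add_smult) (use c d q in auto)
    show ?case
    proof (intro bexI[of _ "c + e \<cdot>\<^sub>v d q"] conjI)
      show "\<exists>X. strip_zero_chain (dseries (?L (c + e \<cdot>\<^sub>v d q))) (Suc r) X"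
        unfolding eq using e by blast
    \<comment> \<open>At \<open>Suc q\<close> the old coefficient vanishes and \<open>d q\<close>
      contributes 1, so the new leading coefficient is \<open>e\<close>.\<close>
    qed (use c d q e in \<open>auto simp: eq simp flip: q_def\<close>)
  qed
  from this[of k] obtain c X where c: "c \<in> carrier_vec (k + 1)" "?L c 1 \<noteq> 0"
      "strip_zero_chain (dseries (?L c)) k X"
    by auto
  obtain T where T: "T \<subseteq> maximal_strips (?L c)" "finite T" "card T = k"
    using strip_zero_chain_maximal_strips[OF conv[OF c(1)] c(3)] by blast
  \<comment> \<open>Distinct multiples of \<open>c\<close> are told apart by their first
    coefficient.\<close>
  define f where "f n = of_nat (Suc n) \<cdot>\<^sub>v c" for n
  have "inj f"
  proof (rule injI)
    fix m n assume "f m = f n"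
    then have "?L (f m) 1 = ?L (f n) 1" by simp
    then show "m = n" using c(2) by (simp add: f_def lincomb_coeffs_smult del: of_nat_Suc)
  qed
  then have "infinite (range f)" by (rule range_inj_infinite)
  moreover have "range f \<subseteq> {c \<in> carrier_vec (k + 1).
      \<exists>T. T \<subseteq> maximal_strips (?L c) \<and> finite T \<and> card T = k}"
  proof (rule image_subsetI)
    fix n :: nat
    have "maximal_strips (?L (of_nat (Suc n) \<cdot>\<^sub>v c)) = maximal_strips (?L c)"
      unfolding lincomb_coeffs_smult by (rule maximal_strips_scale) (simp del: of_nat_Suc)
    then show "f n \<in> {c \<in> carrier_vec (k + 1).
        \<exists>T. T \<subseteq> maximal_strips (?L c) \<and> finite T \<and> card T = k}"
      using T c(1) by (auto simp: f_def simp del: of_nat_Suc)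
  qed
  ultimately show ?thesis by (rule infinite_super[rotated])
qed

end
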